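(* (Skew semi-continuous limit of the discrete Boussinesq equation B2.) Let $p,b_0\in\mathbb R$, and let $u_{-2},u_{-1},u_0,u_1,u_2:\mathbb R\to\mathbb R$ be smooth. Fix $\tau\in\mathbb R$ with $\dot u_0(\tau)+1\neq0$. For $\delta\neq0$ small put $q=p-\delta$, $P=p^3-b_0p^2$, $Q=q^3-b_0q^2$, and for $\nu,\mu\in\{-1,0,1\}$ set $$x_{\nu,\mu}=p\nu+q\mu+u_{\nu+\mu}\big(\tau+\tfrac12(\nu-\mu)\delta\big).$$ Let $$E=(P-Q)\left(\frac1{x_{1,-1}-x_{0,0}}-\frac1{x_{0,0}-x_{-1,1}}\right)+b_0(x_{-1,0}-x_{0,-1}+x_{1,0}-x_{0,1})-(x_{1,1}-x_{-1,0})(x_{1,0}-x_{0,1})-(x_{-1,-1}-x_{1,0})(x_{0,-1}-x_{-1,0}).$$ Then, as $\delta\to0$, $-(\dot u_0+1)^2\,E/\delta$ converges to $$(3p^2-2pb_0)\,\ddot u_0+(\dot u_0+1)^2\big[(u_2-u_{-1}-b_0+3p)(\dot u_1+1)+(u_{-2}-u_1+b_0-3p)(\dot u_{-1}+1)\big],$$ where all functions are evaluated at $\tau$.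
   Context: Dots denote derivatives with respect to $\tau$. $E=0$ is the one-component form of the B2 lattice Boussinesq equation on a $3\times3$ stencil centred at the origin; the vanishing of the limit is its skew semi-continuous limit. *)

theory Defs
  imports "HOL-Analysis.Analysis"
begin

definition smooth :: "(real \<Rightarrow> real) \<Rightarrow> bool" where
  "smooth f \<longleftrightarrow> (\<forall>n t. (deriv ^^ n) f field_differentiable (at t))"

(* Left-hand side of the one-component B2 lattice Boussinesq equation on the 3 x 3 stencil
   centred at the origin; only the values x i j with i, j in {-1, 0, 1} are used. *)
definition boussinesq_B2 :: "real \<Rightarrow> real \<Rightarrow> real \<Rightarrow> (int \<Rightarrow> int \<Rightarrow> real) \<Rightarrow> real" where
  "boussinesq_B2 p q b0 x =
    (let P = p ^ 3 - b0 * p ^ 2; Q = q ^ 3 - b0 * q ^ 2 in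
       (P - Q) * (1 / (x 1 (-1) - x 0 0) - 1 / (x 0 0 - x (-1) 1))
       + b0 * (x (-1) 0 - x 0 (-1) + x 1 0 - x 0 1)
       - (x 1 1 - x (-1) 0) * (x 1 0 - x 0 1)
       - (x (-1) (-1) - x 1 0) * (x 0 (-1) - x (-1) 0))"

definition skew_lattice ::
    "real \<Rightarrow> (int \<Rightarrow> real \<Rightarrow> real) \<Rightarrow> real \<Rightarrow> real \<Rightarrow> int \<Rightarrow> int \<Rightarrow> real" where
  "skew_lattice p u \<tau> \<delta> \<nu> \<mu> =
    p * of_int \<nu> + (p - \<delta>) * of_int \<mu> + u (\<nu> + \<mu>) (\<tau> + (1 / 2) * of_int (\<nu> - \<mu>) * \<delta>)"

end

(* The nonlinear term of the equation is R (B - A) / (A B), where A and B are the forward and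
   backward difference quotients of u 0 (plus 1) and R = (P - Q) / \<delta>.  Dividing by \<delta> produces a
   second central difference of u 0; the remaining terms divided by \<delta> are central difference
   quotients of u 1 and u (-1) with convergent coefficients. *)
theory Submission
  imports Defs
begin

lemma smooth_has_real_derivative:
  assumes "smooth f"
  shows "(f has_real_derivative deriv f t) (at t)"
    and "(deriv f has_real_derivative deriv (deriv f) t) (at t)"
proof -
  have "(deriv ^^ 0) f field_differentiable at t" "(deriv ^^ 1) f field_differentiable at t"
    using assms unfolding smooth_def by blast+
  then show "(f has_real_derivative deriv f t) (at t)"
      "(deriv f has_real_derivative deriv (deriv f) t) (at t)"
    by (simp_all add: DERIV_deriv_iff_field_differentiable)
qed

text \<open>The numerator vanishes at \<open>h = 0\<close> and has derivative
  \<open>(a + b) * d\<close> there, so the quotient is an ordinary difference quotient at 0. The two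
  parameters cover the forward (1, 0), backward (0, 1) and half-step central (1/2, 1/2)
  cases.\<close>

lemma difference_quotient_tendsto:
  fixes f :: "real \<Rightarrow> real"
  assumes "(f has_real_derivative d) (at t)"
  shows "((\<lambda>h. (f (t + a * h) - f (t - b * h)) / h) \<longlongrightarrow> (a + b) * d) (at 0)"
proof -
  have "((\<lambda>h. f (t + a * h) - f (t - b * h)) has_real_derivative d * a - d * (- b)) (at 0)"
    by (intro DERIV_diff DERIV_chain2[where f = f])
       (use assms in \<open>auto intro!: derivative_eq_intros\<close>)
  then show ?thesis
    by (simp add: has_field_derivative_iff algebra_simps)
qed

text \<open>One use of l'Hopital's rule turns the quotient into half the central difference of
  \<open>f'\<close>, which converges by differentiability of \<open>f'\<close> at the point
  \<open>t\<close>. A second use would ask for a derivative of \<open>f'\<close> near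
  \<open>t\<close>.\<close>

lemma second_difference_tendsto:
  fixes f f' :: "real \<Rightarrow> real"
  assumes f: "\<And>s. (f has_real_derivative f' s) (at s)"
    and f': "(f' has_real_derivative d) (at t)"
  shows "((\<lambda>h. (f (t + h) - 2 * f t + f (t - h)) / h ^ 2) \<longlongrightarrow> d) (at 0)"
proof (rule lhopital)
  have deriv: "((\<lambda>h. f (t + h) - 2 * f t + f (t - h)) has_real_derivative
      f' (t + h) * 1 - 0 + f' (t - h) * (- 1)) (at h)" for h
    by (intro DERIV_add DERIV_diff DERIV_chain2[where f = f] f)
       (auto intro!: derivative_eq_intros)
  then show "\<forall>\<^sub>F h in at 0. ((\<lambda>h. f (t + h) - 2 * f t + f (t - h)) has_real_derivative
      f' (t + h) - f' (t - h)) (at h)"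
    by simp
  show "((\<lambda>h. f (t + h) - 2 * f t + f (t - h)) \<longlongrightarrow> 0) (at 0)"
    using DERIV_isCont[OF deriv[of 0]] by (simp add: isCont_def)
  show "((\<lambda>h::real. h ^ 2) \<longlongrightarrow> 0) (at 0)"
    by (auto intro!: tendsto_eq_intros)
  show "\<forall>\<^sub>F h::real in at 0. h ^ 2 \<noteq> 0" "\<forall>\<^sub>F h::real in at 0. 2 * h \<noteq> 0"
    by (auto simp: eventually_at_filter)
  show "\<forall>\<^sub>F h::real in at 0. ((\<lambda>h. h ^ 2) has_real_derivative 2 * h) (at h)"
    using DERIV_pow[of 2] by simp
  show "((\<lambda>h. (f' (t + h) - f' (t - h)) / (2 * h)) \<longlongrightarrow> d) (at 0)"
    using tendsto_mult_left[OF difference_quotient_tendsto[OF f', of 1 1], of "1 / 2"] by simp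
qed

text \<open>An exact identity, before any limit: stencil points with equal index sum carry the same
  \<open>u k\<close>, so their differences are \<delta> times difference quotients. One factor
  \<delta> then comes out of every term.\<close>

lemma boussinesq_B2_skew_lattice:
  fixes p b0 \<tau> \<delta> :: real and u :: "int \<Rightarrow> real \<Rightarrow> real"
  defines "A \<equiv> (u 0 (\<tau> + \<delta>) - u 0 \<tau>) / \<delta> + 1"
    and "B \<equiv> (u 0 \<tau> - u 0 (\<tau> - \<delta>)) / \<delta> + 1"
    and "C \<equiv> (\<lambda>k. (u k (\<tau> + 1 / 2 * \<delta>) - u k (\<tau> - 1 / 2 * \<delta>)) / \<delta> + 1)"
  assumes "\<delta> \<noteq> 0" "A \<noteq> 0" "B \<noteq> 0"
  shows "boussinesq_B2 p (p - \<delta>) b0 (skew_lattice p u \<tau> \<delta>) / \<delta> =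
    - ((p ^ 2 + p * (p - \<delta>) + (p - \<delta>) ^ 2 - b0 * (2 * p - \<delta>))
        * ((u 0 (\<tau> + \<delta>) - 2 * u 0 \<tau> + u 0 (\<tau> - \<delta>)) / \<delta> ^ 2) / (A * B)
      + (u 2 \<tau> - u (-1) (\<tau> - 1 / 2 * \<delta>) - b0 + 3 * p - \<delta>) * C 1
      + (u (-2) \<tau> - u 1 (\<tau> + 1 / 2 * \<delta>) + b0 - 3 * p + \<delta>) * C (-1))"
proof -
  let ?x = "skew_lattice p u \<tau> \<delta>"
  let ?R = "p ^ 2 + p * (p - \<delta>) + (p - \<delta>) ^ 2 - b0 * (2 * p - \<delta>)"
  let ?S = "(u 0 (\<tau> + \<delta>) - 2 * u 0 \<tau> + u 0 (\<tau> - \<delta>)) / \<delta> ^ 2"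
  \<comment> \<open>Since p - q = \<delta>, both p^3 - q^3 and p^2 - q^2 are divisible by \<delta>;
    the cofactor tends to 3p^2 - 2p b0.\<close>
  have R: "(p ^ 3 - b0 * p ^ 2) - ((p - \<delta>) ^ 3 - b0 * (p - \<delta>) ^ 2) = \<delta> * ?R"
    by algebra
  \<comment> \<open>The summand 1 in \<open>A\<close>, \<open>B\<close> and \<open>C\<close> comes
    from the linear background: each of these steps changes p\<nu> + q\<mu> by p - q =
    \<delta>.\<close>
  have dA: "?x 1 (-1) - ?x 0 0 = \<delta> * A" and dB: "?x 0 0 - ?x (-1) 1 = \<delta> * B"
    using \<open>\<delta> \<noteq> 0\<close> by (simp_all add: skew_lattice_def A_def B_def field_simps)
  have dC: "?x 1 0 - ?x 0 1 = \<delta> * C 1" and dD: "?x 0 (-1) - ?x (-1) 0 = \<delta> * C (-1)"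
    using \<open>\<delta> \<noteq> 0\<close> by (simp_all add: skew_lattice_def C_def field_simps)
  have co: "?x 1 1 - ?x (-1) 0 = u 2 \<tau> - u (-1) (\<tau> - 1 / 2 * \<delta>) + 3 * p - \<delta>"
    "?x (-1) (-1) - ?x 1 0 = u (-2) \<tau> - u 1 (\<tau> + 1 / 2 * \<delta>) - 3 * p + \<delta>"
    by (simp_all add: skew_lattice_def)
  \<comment> \<open>The summands 1 cancel, and the extra factor \<delta> gained here offsets the
    1/\<delta> in the difference of reciprocals.\<close>
  have "A - B = \<delta> * ?S"
    using \<open>\<delta> \<noteq> 0\<close> by (simp add: A_def B_def field_simps power2_eq_square)
  then have "1 / (\<delta> * A) - 1 / (\<delta> * B) = - ?S / (A * B)"
    using assms(4-6) by (simp add: divide_simps) algebra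
  moreover have "?x (-1) 0 - ?x 0 (-1) + ?x 1 0 - ?x 0 1 = \<delta> * C 1 - \<delta> * C (-1)"
    using dC dD by simp
  ultimately have "boussinesq_B2 p (p - \<delta>) b0 ?x =
      \<delta> * ?R * (- ?S / (A * B)) + b0 * (\<delta> * C 1 - \<delta> * C (-1))
      - (u 2 \<tau> - u (-1) (\<tau> - 1 / 2 * \<delta>) + 3 * p - \<delta>) * (\<delta> * C 1)
      - (u (-2) \<tau> - u 1 (\<tau> + 1 / 2 * \<delta>) - 3 * p + \<delta>) * (\<delta> * C (-1))"
    unfolding boussinesq_B2_def Let_def R dA dB dC dD co by simp
  \<comment> \<open>The linear \<open>b0\<close> term is absorbed into the coefficients of
    \<open>C 1\<close> and \<open>C (-1)\<close>, with opposite signs.\<close>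
  also have "\<dots> = \<delta> * (- (?R * ?S / (A * B)
      + (u 2 \<tau> - u (-1) (\<tau> - 1 / 2 * \<delta>) - b0 + 3 * p - \<delta>) * C 1
      + (u (-2) \<tau> - u 1 (\<tau> + 1 / 2 * \<delta>) + b0 - 3 * p + \<delta>) * C (-1)))"
    unfolding times_divide_eq_right[symmetric] divide_inverse by algebra
  finally show ?thesis
    using \<open>\<delta> \<noteq> 0\<close> by simp
qed

theorem mainTheorem6:
  fixes p b0 \<tau> :: real and u :: "int \<Rightarrow> real \<Rightarrow> real"
  assumes "\<And>k. k \<in> {-2..2} \<Longrightarrow> smooth (u k)"
    and "deriv (u 0) \<tau> + 1 \<noteq> 0"
  shows "((\<lambda>\<delta>. - ((deriv (u 0) \<tau> + 1) ^ 2)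
              * boussinesq_B2 p (p - \<delta>) b0 (skew_lattice p u \<tau> \<delta>) / \<delta>)
          \<longlongrightarrow>
            (3 * p ^ 2 - 2 * p * b0) * deriv (deriv (u 0)) \<tau>
            + (deriv (u 0) \<tau> + 1) ^ 2
              * ((u 2 \<tau> - u (-1) \<tau> - b0 + 3 * p) * (deriv (u 1) \<tau> + 1)
                 + (u (-2) \<tau> - u 1 \<tau> + b0 - 3 * p) * (deriv (u (-1)) \<tau> + 1)))
         (at 0)"
proof -
  let ?a = "deriv (u 0) \<tau> + 1"
  define A where "A \<delta> = (u 0 (\<tau> + \<delta>) - u 0 \<tau>) / \<delta> + 1" for \<delta>
  define B where "B \<delta> = (u 0 \<tau> - u 0 (\<tau> - \<delta>)) / \<delta> + 1" for \<delta>
  define C where "C \<delta> k = (u k (\<tau> + 1 / 2 * \<delta>) - u k (\<tau> - 1 / 2 * \<delta>)) / \<delta> + 1" for \<delta> k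
  define S where "S \<delta> = (u 0 (\<tau> + \<delta>) - 2 * u 0 \<tau> + u 0 (\<tau> - \<delta>)) / \<delta> ^ 2" for \<delta>
  \<comment> \<open>\<open>G\<close> is -E/\<delta> in the form given by the identity above, so that
    its limit can be taken factor by factor.\<close>
  define G where "G \<delta> =
    (p ^ 2 + p * (p - \<delta>) + (p - \<delta>) ^ 2 - b0 * (2 * p - \<delta>)) * S \<delta> / (A \<delta> * B \<delta>)
      + (u 2 \<tau> - u (-1) (\<tau> - 1 / 2 * \<delta>) - b0 + 3 * p - \<delta>) * C \<delta> 1
      + (u (-2) \<tau> - u 1 (\<tau> + 1 / 2 * \<delta>) + b0 - 3 * p + \<delta>) * C \<delta> (-1)" for \<delta>
  have deriv_u: "(u k has_real_derivative deriv (u k) t) (at t)"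
    and deriv2_u: "(deriv (u k) has_real_derivative deriv (deriv (u k)) t) (at t)"
    if "k \<in> {-2..2}" for k t
    using smooth_has_real_derivative[OF assms(1)[OF that]] by auto
  have A: "(A \<longlongrightarrow> ?a) (at 0)"
    using tendsto_add[OF difference_quotient_tendsto[OF deriv_u[of 0 \<tau>], of 1 0] tendsto_const[of 1]]
    by (simp add: A_def[abs_def])
  have B: "(B \<longlongrightarrow> ?a) (at 0)"
    using tendsto_add[OF difference_quotient_tendsto[OF deriv_u[of 0 \<tau>], of 0 1] tendsto_const[of 1]]
    by (simp add: B_def[abs_def])
  have C: "((\<lambda>\<delta>. C \<delta> k) \<longlongrightarrow> deriv (u k) \<tau> + 1) (at 0)" if "k \<in> {-2..2}" for k
    using tendsto_add[OF difference_quotient_tendsto[OF deriv_u[OF that, of \<tau>], of "1/2" "1/2"]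
        tendsto_const[of 1]]
    by (simp add: C_def[abs_def])
  have S: "(S \<longlongrightarrow> deriv (deriv (u 0)) \<tau>) (at 0)"
    using second_difference_tendsto[OF deriv_u[of 0] deriv2_u[of 0 \<tau>]]
    by (simp add: S_def[abs_def])
  have u_cont: "isCont (u k) \<tau>" if "k \<in> {-2..2}" for k
    using deriv_u[OF that] DERIV_isCont by blast
  have u_minus: "((\<lambda>\<delta>. u (-1) (\<tau> - 1 / 2 * \<delta>)) \<longlongrightarrow> u (-1) \<tau>) (at 0)"
    by (rule isCont_tendsto_compose[OF u_cont]) (auto intro!: tendsto_eq_intros)
  have u_plus: "((\<lambda>\<delta>. u 1 (\<tau> + 1 / 2 * \<delta>)) \<longlongrightarrow> u 1 \<tau>) (at 0)"
    by (rule isCont_tendsto_compose[OF u_cont]) (auto intro!: tendsto_eq_intros)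
  \<comment> \<open>\<open>A\<close> and \<open>B\<close> have the same limit \<open>c\<close>, so
    the prefactor clears the denominator of the first term and remains on the others.\<close>
  have cancel: "c ^ 2 * (r / (c * c) + y) = r + c ^ 2 * y" if "c \<noteq> 0" for c r y :: real
    using that by (simp add: distrib_left power2_eq_square)
  \<comment> \<open>The limit is written with \<delta> replaced by 0 literally, to match what the
    limit rules produce; it is simplified afterwards.\<close>
  have "((\<lambda>\<delta>. ?a ^ 2 * G \<delta>) \<longlongrightarrow> ?a ^ 2 *
      ((p ^ 2 + p * (p - 0) + (p - 0) ^ 2 - b0 * (2 * p - 0)) * deriv (deriv (u 0)) \<tau> / (?a * ?a)
      + (u 2 \<tau> - u (-1) \<tau> - b0 + 3 * p - 0) * (deriv (u 1) \<tau> + 1)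
      + (u (-2) \<tau> - u 1 \<tau> + b0 - 3 * p + 0) * (deriv (u (-1)) \<tau> + 1))) (at 0)"
    unfolding G_def
    by (intro tendsto_intros A B C S u_minus u_plus) (use assms(2) in auto)
  also have "?a ^ 2 *
      ((p ^ 2 + p * (p - 0) + (p - 0) ^ 2 - b0 * (2 * p - 0)) * deriv (deriv (u 0)) \<tau> / (?a * ?a)
      + (u 2 \<tau> - u (-1) \<tau> - b0 + 3 * p - 0) * (deriv (u 1) \<tau> + 1)
      + (u (-2) \<tau> - u 1 \<tau> + b0 - 3 * p + 0) * (deriv (u (-1)) \<tau> + 1))
    = (3 * p ^ 2 - 2 * p * b0) * deriv (deriv (u 0)) \<tau>
      + ?a ^ 2 * ((u 2 \<tau> - u (-1) \<tau> - b0 + 3 * p) * (deriv (u 1) \<tau> + 1)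
        + (u (-2) \<tau> - u 1 \<tau> + b0 - 3 * p) * (deriv (u (-1)) \<tau> + 1))"
    unfolding add.assoc cancel[OF assms(2)] by algebra
  finally have lim: "((\<lambda>\<delta>. ?a ^ 2 * G \<delta>) \<longlongrightarrow> \<dots>) (at 0)" .
  \<comment> \<open>The nonzero common limit keeps both denominators away from 0 near \<delta> = 0,
    so the exact identity applies there.\<close>
  have "\<forall>\<^sub>F \<delta> in at 0. A \<delta> \<noteq> 0" "\<forall>\<^sub>F \<delta> in at 0. B \<delta> \<noteq> 0"
    using tendsto_imp_eventually_ne[OF A assms(2)] tendsto_imp_eventually_ne[OF B assms(2)] by auto
  moreover have "\<forall>\<^sub>F \<delta>::real in at 0. \<delta> \<noteq> 0"
    by (auto simp: eventually_at_filter)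
  ultimately have "\<forall>\<^sub>F \<delta> in at 0. ?a ^ 2 * G \<delta> =
      - (?a ^ 2) * boussinesq_B2 p (p - \<delta>) b0 (skew_lattice p u \<tau> \<delta>) / \<delta>"
  proof eventually_elim
    case (elim \<delta>)
    have "boussinesq_B2 p (p - \<delta>) b0 (skew_lattice p u \<tau> \<delta>) / \<delta> = - G \<delta>"
      using boussinesq_B2_skew_lattice[of \<delta> u \<tau> p b0] elim
      unfolding G_def A_def B_def C_def S_def by blast
    then show ?case
      by (metis minus_mult_minus times_divide_eq_right)
  qed
  from Lim_transform_eventually[OF lim this] show ?thesis .
qed

end
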